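(* For the triangle game on the triangular grid with $n$ winning sets, $\mathrm{SC}_2(\mathcal G_{\triangle},2)\ge \frac{3n}{8}-o(n)$.
   Context: An $s$-of-$k$ game on a $k$-uniform hypergraph $(V,\mathcal F)$ (winning sets are $k$-element subsets of the finite set $V$), $1\le s\le k$: Maker and Breaker alternately claim unclaimed vertices, Maker first, until all are claimed; the score is the number of winning sets in which Maker claimed at least $s$ vertices (Maker maximizes, Breaker minimizes). A pairing strategy for Maker: she fixes in advance pairwise disjoint pairs of vertices and, whenever Breaker claims a vertex of a pair whose partner is unclaimed, she claims the partner (other moves arbitrary). $\mathrm{SC}_2(\mathcal H,s)$ is the largest score Maker can guarantee against every Breaker strategy using a pairing strategy. $\mathcal G_{\triangle}$ is the hypergraph whose vertices are the points of a finite portion of the triangular lattice and whose winning sets are the vertex sets of the unit triangular faces (both orientations), so $k=3$. Grids are assumed "two-dimensional": the number of winning sets within constant distance of the boundary is $o(n)$, where $n$ is the number of winning sets; $o(n)$ refers to $n\to\infty$. *)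

theory Defs
  imports Complex_Main "HOL-Library.Landau_Symbols"
begin

text \<open>
  The \<open>s\<close>-of-\<open>k\<close> scoring game on a hypergraph with finite vertex set \<open>V\<close> and set \<open>W\<close> of
  winning sets. A history is the list of the vertices claimed so far; Maker moves first, so hers
  are the entries at even positions. A strategy maps histories to the next vertex claimed; its
  values outside the positions of the game are irrelevant.
\<close>

type_synonym 'v strategy = "'v list \<Rightarrow> 'v"

definition legal_strategy :: "'v set \<Rightarrow> 'v strategy \<Rightarrow> bool" where
  "legal_strategy V \<sigma> \<longleftrightarrow> (\<forall>h. distinct h \<and> set h \<subset> V \<longrightarrow> \<sigma> h \<in> V - set h)"

fun play :: "'v strategy \<Rightarrow> 'v strategy \<Rightarrow> nat \<Rightarrow> 'v list" where
  "play \<sigma> \<tau> 0 = []"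
| "play \<sigma> \<tau> (Suc m) = play \<sigma> \<tau> m @ [if even m then \<sigma> (play \<sigma> \<tau> m) else \<tau> (play \<sigma> \<tau> m)]"

definition maker_vertices :: "'v list \<Rightarrow> 'v set" where
  "maker_vertices h = {h ! i | i. i < length h \<and> even i}"

definition score :: "'v set \<Rightarrow> 'v set set \<Rightarrow> nat \<Rightarrow> 'v strategy \<Rightarrow> 'v strategy \<Rightarrow> nat" where
  "score V W s \<sigma> \<tau> = card {A \<in> W. s \<le> card (A \<inter> maker_vertices (play \<sigma> \<tau> (card V)))}"

definition pairing :: "'v set \<Rightarrow> 'v set set \<Rightarrow> bool" where
  "pairing V M \<longleftrightarrow> (\<forall>e\<in>M. e \<subseteq> V \<and> card e = 2) \<and> pairwise disjnt M"

definition follows_pairing :: "'v set \<Rightarrow> 'v set set \<Rightarrow> 'v strategy \<Rightarrow> bool" where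
  "follows_pairing V M \<sigma> \<longleftrightarrow> legal_strategy V \<sigma> \<and>
     (\<forall>h x y. distinct (h @ [x]) \<and> set (h @ [x]) \<subseteq> V \<and> odd (length h) \<and>
        {x, y} \<in> M \<and> y \<notin> set (h @ [x]) \<longrightarrow> \<sigma> (h @ [x]) = y)"

text \<open>
  A pairing guarantees \<open>t\<close> if every Maker strategy following it scores at least \<open>t\<close> against every
  Breaker strategy: the moves the pairing does not prescribe are arbitrary and may not be relied
  upon. (If they could be optimised, the empty pairing would admit every strategy.)
\<close>

definition pairing_guarantees :: "'v set \<Rightarrow> 'v set set \<Rightarrow> nat \<Rightarrow> 'v set set \<Rightarrow> nat \<Rightarrow> bool" where
  "pairing_guarantees V W s M t \<longleftrightarrow>
     (\<forall>\<sigma> \<tau>. follows_pairing V M \<sigma> \<and> legal_strategy V \<tau> \<longrightarrow> t \<le> score V W s \<sigma> \<tau>)"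

definition SC2 :: "'v set \<Rightarrow> 'v set set \<Rightarrow> nat \<Rightarrow> nat" where
  "SC2 V W s = Max {t. \<exists>M. pairing V M \<and> pairing_guarantees V W s M t}"

lemma ex_follows_pairing:
  assumes M: "pairing V M"
  shows "\<exists>\<sigma>. follows_pairing V M \<sigma>"
proof -
  define P where "P h y \<longleftrightarrow> (\<exists>h' x. h = h' @ [x] \<and> odd (length h') \<and> {x, y} \<in> M \<and> y \<notin> set h)"
    for h y
  define \<sigma> where "\<sigma> h = (if \<exists>y. P h y then SOME y. P h y else SOME v. v \<in> V - set h)" for h
  have P_unique: "y = z" if "P h y" "P h z" for h y z
  proof -
    from that obtain x where x: "{x, y} \<in> M" "{x, z} \<in> M" "y \<noteq> x" "z \<noteq> x"
      unfolding P_def by force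
    have "pairwise disjnt M" using M by (simp add: pairing_def)
    from pairwiseD[OF this x(1,2)] have "{x, y} = {x, z}" by (auto simp: disjnt_def)
    with x show ?thesis by (auto simp: doubleton_eq_iff)
  qed
  have P_\<sigma>: "\<sigma> h = y" if "P h y" for h y
  proof -
    have "(SOME y. P h y) = y" using that P_unique[OF _ that] by (rule some_equality)
    with that show ?thesis by (auto simp: \<sigma>_def)
  qed
  have "\<sigma> h \<in> V - set h" if "set h \<subset> V" for h
  proof (cases "\<exists>y. P h y")
    case True
    then obtain y where y: "P h y" by blast
    then have "y \<in> V - set h" using M by (auto simp: P_def pairing_def)
    with P_\<sigma>[OF y] show ?thesis by simp
  next
    case False
    then have "\<sigma> h = (SOME v. v \<in> V - set h)" by (simp add: \<sigma>_def)
    moreover have "\<exists>v. v \<in> V - set h" using that by blast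
    ultimately show ?thesis using someI_ex[of "\<lambda>v. v \<in> V - set h"] by simp
  qed
  moreover have "\<sigma> (h @ [x]) = y"
    if "odd (length h)" "{x, y} \<in> M" "y \<notin> set (h @ [x])" for h x y
    using that by (intro P_\<sigma>) (auto simp: P_def)
  ultimately show ?thesis
    unfolding follows_pairing_def legal_strategy_def by (intro exI[of _ \<sigma>]) simp
qed

lemma
  fixes V :: "'v set"
  defines "G \<equiv> \<lambda>W s. {t. \<exists>M. pairing V M \<and> pairing_guarantees V W s M t}"
  assumes V: "finite V" and W: "finite W"
  shows finite_SC2_candidates: "finite (G W s)"
    and SC2_candidates_nonempty: "G W s \<noteq> {}"
proof -
  have "pairing V {}" "pairing_guarantees V W s {} 0"
    by (auto simp: pairing_def pairing_guarantees_def)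
  then show "G W s \<noteq> {}" unfolding G_def by blast
  have "t \<le> card W" if "t \<in> G W s" for t
  proof -
    from that obtain M where M: "pairing V M" "pairing_guarantees V W s M t"
      unfolding G_def by blast
    then obtain \<sigma> where \<sigma>: "follows_pairing V M \<sigma>" using ex_follows_pairing by blast
    then have "t \<le> score V W s \<sigma> \<sigma>"
      using M(2) by (simp add: pairing_guarantees_def follows_pairing_def)
    also have "\<dots> \<le> card W" unfolding score_def by (intro card_mono W) auto
    finally show ?thesis .
  qed
  then show "finite (G W s)"
    by (meson finite_nat_set_iff_bounded_le)
qed

text \<open>
  The triangular lattice in coordinates with respect to two unit vectors at angle \<open>\<pi>/3\<close>: the
  pair \<open>(a, b)\<close> stands for the point \<open>a + b \<cdot> cis (\<pi>/3)\<close> of the complex plane.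
\<close>

type_synonym point = "int \<times> int"

definition triangles :: "point set set" where
  "triangles = {{(a, b), (a + 1, b), (a, b + 1)} | a b. True}
             \<union> {{(a + 1, b), (a, b + 1), (a + 1, b + 1)} | a b. True}"

text \<open>The winning sets of the triangle game on the portion \<open>V\<close> of the lattice.\<close>

definition grid_triangles :: "point set \<Rightarrow> point set set" where
  "grid_triangles V = {A \<in> triangles. A \<subseteq> V}"

lemma card_triangle: "A \<in> triangles \<Longrightarrow> card A = 3"
  by (auto simp: triangles_def)

lemma finite_grid_triangles: "finite V \<Longrightarrow> finite (grid_triangles V)"
  unfolding grid_triangles_def by (rule finite_subset[of _ "Pow V"]) auto

definition lattice_edges :: "(point \<times> point) set" where
  "lattice_edges = {(p, q). p \<noteq> q \<and> (\<exists>A\<in>triangles. p \<in> A \<and> q \<in> A)}"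

definition boundary :: "point set \<Rightarrow> point set" where
  "boundary V = {p \<in> V. \<exists>q. q \<notin> V \<and> (p, q) \<in> lattice_edges}"

text \<open>Distance is the graph distance of the lattice.\<close>

definition near_boundary :: "nat \<Rightarrow> point set \<Rightarrow> point set set" where
  "near_boundary d V = {A \<in> grid_triangles V.
     \<exists>p\<in>A. \<exists>q\<in>boundary V. \<exists>j\<le>d. (p, q) \<in> lattice_edges ^^ j}"

text \<open>
  A single finite grid cannot satisfy an asymptotic condition, so two-dimensionality is a property
  of a class of grids; the \<open>o(n)\<close> bound is uniform over the class, for each fixed distance \<open>d\<close>.
\<close>

definition two_dimensional :: "point set set \<Rightarrow> bool" where
  "two_dimensional \<G> \<longleftrightarrow>
     (\<forall>d. \<exists>\<beta> \<in> o(\<lambda>n. real n). \<forall>V\<in>\<G>. real (card (near_boundary d V)) \<le> \<beta> (card (grid_triangles V)))"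

end

theory Submission
  imports Defs
begin

text \<open>
  Cut the lattice into horizontal strips of four rows and match consecutive strips by the vertical
  translation by four rows. A triangle inside a strip is thereby matched vertex by vertex with its
  translate, and since Maker gets a vertex of every pair, she gets two vertices of one of the two
  triangles. One of the four possible offsets of the strips leaves at most a quarter of the
  triangles straddling two strips, so, up to boundary effects, Maker wins half of three quarters of
  all triangles.
\<close>

section \<open>Pairing strategies\<close>

lemma length_play [simp]: "length (play \<sigma> \<tau> m) = m"
  by (induction m) auto

lemma take_play: "i \<le> m \<Longrightarrow> take i (play \<sigma> \<tau> m) = play \<sigma> \<tau> i"
  by (induction m) (auto simp: le_Suc_eq)

lemma play_legal:
  assumes "legal_strategy V \<sigma>" "legal_strategy V \<tau>" "m \<le> card V"
  shows "distinct (play \<sigma> \<tau> m) \<and> set (play \<sigma> \<tau> m) \<subseteq> V"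
  using assms(3)
proof (induction m)
  case (Suc m)
  then have IH: "distinct (play \<sigma> \<tau> m)" "set (play \<sigma> \<tau> m) \<subseteq> V" by auto
  have "card (set (play \<sigma> \<tau> m)) = m" using IH(1) by (simp add: distinct_card)
  then have "set (play \<sigma> \<tau> m) \<subset> V" using IH(2) Suc.prems by auto
  then have "\<sigma> (play \<sigma> \<tau> m) \<in> V - set (play \<sigma> \<tau> m)" "\<tau> (play \<sigma> \<tau> m) \<in> V - set (play \<sigma> \<tau> m)"
    using assms(1,2) IH(1) unfolding legal_strategy_def by blast+
  with IH show ?case by auto
qed simp

lemma set_play_full:
  assumes "legal_strategy V \<sigma>" "legal_strategy V \<tau>" "finite V"
  shows "set (play \<sigma> \<tau> (card V)) = V"
  using play_legal[OF assms(1,2) order_refl] assms(3)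
  by (intro card_subset_eq) (auto simp: distinct_card)

text \<open>Breaker's moves are those at odd positions. When he takes \<open>h ! i\<close> its
  partner \<open>h ! j\<close> is still unclaimed because \<open>i < j\<close>, so the pairing
  dictates Maker's next move. As no vertex is claimed twice, \<open>j\<close> must be that very
  position.\<close>

lemma follows_pairing_answer:
  assumes \<sigma>: "follows_pairing V M \<sigma>" and \<tau>: "legal_strategy V \<tau>"
    and xy: "{h ! i, h ! j} \<in> M" and h: "h = play \<sigma> \<tau> (card V)"
    and ij: "i < j" "j < card V" "odd i"
  shows "j = Suc i"
proof -
  have legal: "legal_strategy V \<sigma>" using \<sigma> by (simp add: follows_pairing_def)
  have d: "distinct h" and sub: "set h \<subseteq> V" and len: "length h = card V"
    using play_legal[OF legal \<tau> order_refl] by (auto simp: h)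
  have tk: "take i h @ [h ! i] = play \<sigma> \<tau> (Suc i)"
    using ij take_play[of "Suc i" "card V" \<sigma> \<tau>] by (simp add: take_Suc_conv_app_nth len flip: h)
  have "distinct (play \<sigma> \<tau> (Suc i)) \<and> set (play \<sigma> \<tau> (Suc i)) \<subseteq> V"
    using play_legal[OF legal \<tau>, of "Suc i"] ij by simp
  moreover have "h ! j \<notin> set (take i h @ [h ! i])"
  proof -
    have "h ! j \<noteq> h ! k" if "k \<le> i" for k
      using d ij that by (auto simp: nth_eq_iff_index_eq len)
    moreover have "set (take i h @ [h ! i]) = {h ! k | k. k \<le> i}"
      using ij len unfolding le_less by (auto simp: in_set_conv_nth) fastforce
    ultimately show ?thesis by blast
  qed
  moreover have "odd (length (take i h))" using ij len by simp
  ultimately have "\<sigma> (play \<sigma> \<tau> (Suc i)) = h ! j"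
    using \<sigma> xy unfolding follows_pairing_def tk[symmetric] by blast
  \<comment> \<open>Since \<open>i\<close> is odd, position \<open>Suc i\<close> is Maker's, and it
    is reached because \<open>i < j < card V\<close>.\<close>
  moreover have "h ! Suc i = \<sigma> (play \<sigma> \<tau> (Suc i))"
  proof -
    have "h ! Suc i = take (Suc (Suc i)) h ! Suc i" by simp
    also have "take (Suc (Suc i)) h = play \<sigma> \<tau> (Suc (Suc i))"
      unfolding h using ij by (intro take_play) simp
    also have "\<dots> ! Suc i = \<sigma> (play \<sigma> \<tau> (Suc i))"
      unfolding play.simps(2)[of \<sigma> \<tau> "Suc i"] using ij(3)
      by (simp only: nth_append length_play) simp
    finally show ?thesis .
  qed
  ultimately have "h ! Suc i = h ! j" by simp
  with d ij len show ?thesis by (simp add: nth_eq_iff_index_eq)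
qed

text \<open>If Breaker held both vertices, both positions would be odd, but the later one would have
  to directly follow the earlier one, which contradicts parity.\<close>

lemma maker_hits_pair:
  assumes V: "finite V" and \<sigma>: "follows_pairing V M \<sigma>" and \<tau>: "legal_strategy V \<tau>"
    and xy: "{x, y} \<in> M" "x \<in> V" "y \<in> V" "x \<noteq> y"
  shows "x \<in> maker_vertices (play \<sigma> \<tau> (card V)) \<or> y \<in> maker_vertices (play \<sigma> \<tau> (card V))"
proof (rule ccontr)
  define h where "h = play \<sigma> \<tau> (card V)"
  assume "\<not> ?thesis"
  then have no: "x \<notin> maker_vertices h" "y \<notin> maker_vertices h" by (auto simp: h_def)
  have "set h = V"
    using set_play_full[OF _ \<tau> V] \<sigma> by (simp add: follows_pairing_def h_def)
  then obtain i j where ij: "x = h ! i" "y = h ! j" "i < card V" "j < card V"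
    using xy by (metis h_def in_set_conv_nth length_play)
  then have odd: "odd i" "odd j" using no by (auto simp: maker_vertices_def h_def)
  have "i \<noteq> j" using ij xy by auto
  then consider "i < j" | "j < i" by linarith
  then show False
  proof cases
    case 1
    with follows_pairing_answer[OF \<sigma> \<tau> _ h_def, of i j] ij odd xy show False by auto
  next
    case 2
    with follows_pairing_answer[OF \<sigma> \<tau> _ h_def, of j i] ij odd xy show False
      by (auto simp: insert_commute)
  qed
qed

lemma involution_pairing:
  assumes "\<And>v. f (f v) = v" "\<And>v. f v \<noteq> v"
  shows "pairing V {{v, f v} | v. v \<in> V \<and> f v \<in> V}"
  unfolding pairing_def
proof (intro conjI ballI pairwiseI)
  fix e e' assume "e \<in> {{v, f v} | v. v \<in> V \<and> f v \<in> V}" "e' \<in> {{v, f v} | v. v \<in> V \<and> f v \<in> V}"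
    and "e \<noteq> e'"
  then show "disjnt e e'" using assms(1) by (auto simp: disjnt_def) metis+
qed (use assms in \<open>auto simp: card_insert_if eq_commute\<close>)

text \<open>Winning sets have odd size \<open>2 * s - 1\<close>. Every vertex of \<open>A\<close>
  that Maker misses has its partner in \<open>f\<close>
  A\<open>on her side, so her shares of\<close>A\<open>and\<close>f \<open>A\<close> add up to at
  least \<open>2 * s - 1\<close> and one of them reaches \<open>s\<close>. The factor 2 pays for
  charging \<open>A\<close> either to itself or to its image.\<close>

lemma involution_pairing_score:
  fixes f :: "'v \<Rightarrow> 'v"
  assumes inv: "\<And>v. f (f v) = v" and nofix: "\<And>v. f v \<noteq> v" and V: "finite V"
    and W: "finite W" "\<And>A. A \<in> W \<Longrightarrow> A \<subseteq> V" "\<And>A. A \<in> W \<Longrightarrow> card A + 1 = 2 * s"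
    and \<sigma>: "follows_pairing V {{v, f v} | v. v \<in> V \<and> f v \<in> V} \<sigma>" and \<tau>: "legal_strategy V \<tau>"
  shows "card {A \<in> W. f ` A \<in> W} \<le> 2 * score V W s \<sigma> \<tau>"
proof -
  define S where "S = maker_vertices (play \<sigma> \<tau> (card V))"
  define G where "G = {A \<in> W. s \<le> card (A \<inter> S)}"
  have hit: "v \<in> S \<or> f v \<in> S" if "v \<in> V" "f v \<in> V" for v
    unfolding S_def using that nofix[of v] by (intro maker_hits_pair[OF V \<sigma> \<tau>]) auto
  have inj: "inj f" using inv by (metis injI)
  have "{A \<in> W. f ` A \<in> W} \<subseteq> G \<union> image f ` G"
  proof
    fix A assume "A \<in> {A \<in> W. f ` A \<in> W}"
    then have A: "A \<in> W" "f ` A \<in> W" by auto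
    have fA: "finite A" using A W V finite_subset by metis
    have "f ` (A - S) \<subseteq> f ` A \<inter> S" using hit A W(2) by blast
    then have "card (f ` (A - S)) \<le> card (f ` A \<inter> S)" using fA by (intro card_mono) auto
    then have "card (A - S) \<le> card (f ` A \<inter> S)"
      using card_image[of f "A - S"] inj by (simp add: inj_on_def)
    moreover have "card A = card (A \<inter> S) + card (A - S)"
      using fA by (metis card_Int_Diff)
    ultimately have "s \<le> card (A \<inter> S) \<or> s \<le> card (f ` A \<inter> S)" using W(3)[OF A(1)] by linarith
    moreover have "A = f ` f ` A" using inv by (simp add: image_image)
    ultimately show "A \<in> G \<union> image f ` G" using A unfolding G_def by blast
  qed
  then have "card {A \<in> W. f ` A \<in> W} \<le> card (G \<union> image f ` G)"
    using W(1) by (intro card_mono) (auto simp: G_def)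
  also have "\<dots> \<le> card G + card (image f ` G)" by (rule card_Un_le)
  also have "\<dots> \<le> 2 * card G" using card_image_le[of G "image f"] W(1) by (simp add: G_def)
  finally show ?thesis by (simp add: score_def G_def S_def)
qed

lemma SC2_ge:
  assumes "finite V" "finite W" "pairing V M" "pairing_guarantees V W s M t"
  shows "t \<le> SC2 V W s"
  unfolding SC2_def using assms by (intro Max_ge finite_SC2_candidates) auto

lemma SC2_involution:
  fixes f :: "'v \<Rightarrow> 'v"
  assumes "\<And>v. f (f v) = v" "\<And>v. f v \<noteq> v" "finite V"
    and "finite W" "\<And>A. A \<in> W \<Longrightarrow> A \<subseteq> V" "\<And>A. A \<in> W \<Longrightarrow> card A + 1 = 2 * s"
  shows "card {A \<in> W. f ` A \<in> W} \<le> 2 * SC2 V W s"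
proof -
  \<comment> \<open>Half the count is rounded up, so that doubling it loses nothing when the count
    is odd.\<close>
  have "(card {A \<in> W. f ` A \<in> W} + 1) div 2 \<le> SC2 V W s"
  proof (rule SC2_ge[OF assms(3,4) involution_pairing[of f]])
    show "pairing_guarantees V W s {{v, f v} | v. v \<in> V \<and> f v \<in> V}
      ((card {A \<in> W. f ` A \<in> W} + 1) div 2)"
      unfolding pairing_guarantees_def
    proof (intro allI impI)
      fix \<sigma> \<tau>
      assume "follows_pairing V {{v, f v} | v. v \<in> V \<and> f v \<in> V} \<sigma> \<and> legal_strategy V \<tau>"
      with involution_pairing_score[of f, OF assms]
      have "card {A \<in> W. f ` A \<in> W} \<le> 2 * score V W s \<sigma> \<tau>" by blast
      then show "(card {A \<in> W. f ` A \<in> W} + 1) div 2 \<le> score V W s \<sigma> \<tau>" by linarith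
    qed
  qed (use assms in auto)
  then show ?thesis by linarith
qed

section \<open>Strips of the triangular lattice\<close>

text \<open>The strips start at the rows congruent to \<open>c\<close> modulo 4.\<close>

definition strip_swap :: "int \<Rightarrow> point \<Rightarrow> point" where
  "strip_swap c p = (fst p, if (snd p - c) mod 8 < 4 then snd p + 4 else snd p - 4)"

text \<open>A shift by 4 in either direction exchanges the residues 0 to 3 and 4 to 7 modulo 8, so
  the second application takes the opposite branch and undoes the first.\<close>

lemma strip_swap_involution: "strip_swap c (strip_swap c p) = p"
proof -
  define m where "m = (snd p - c) mod 8"
  have m: "0 \<le> m" "m < 8" by (auto simp: m_def)
  have "(snd p + 4 - c) mod 8 = (m + 4) mod 8" "(snd p - 4 - c) mod 8 = (m - 4) mod 8"
    by (simp_all add: m_def mod_simps algebra_simps)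
  then have "m < 4 \<Longrightarrow> \<not> (snd p + 4 - c) mod 8 < 4" "\<not> m < 4 \<Longrightarrow> (snd p - 4 - c) mod 8 < 4"
    using m by simp_all
  then show ?thesis by (cases "m < 4") (simp_all add: strip_swap_def flip: m_def)
qed

lemma strip_swap_neq: "strip_swap c p \<noteq> p"
  by (cases p) (auto simp: strip_swap_def)

lemma triangle_rows:
  assumes "A \<in> triangles"
  obtains b where "snd ` A = {b, b + 1}"
proof -
  from assms obtain a b where "A = {(a, b), (a + 1, b), (a, b + 1)} \<or>
      A = {(a + 1, b), (a, b + 1), (a + 1, b + 1)}"
    unfolding triangles_def by blast
  then have "snd ` A = {b, b + 1}" by auto
  then show thesis by (rule that)
qed

lemma translate_triangle:
  assumes "A \<in> triangles"
  shows "(\<lambda>p. (fst p, snd p + t)) ` A \<in> triangles"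
proof -
  from assms obtain a b where "A = {(a, b), (a + 1, b), (a, b + 1)} \<or>
      A = {(a + 1, b), (a, b + 1), (a + 1, b + 1)}"
    unfolding triangles_def by blast
  then have "(\<lambda>p. (fst p, snd p + t)) ` A = {(a, b + t), (a + 1, b + t), (a, (b + t) + 1)} \<or>
      (\<lambda>p. (fst p, snd p + t)) ` A = {(a + 1, b + t), (a, (b + t) + 1), (a + 1, (b + t) + 1)}"
    by (elim disj_forward) (simp_all add: add.commute add.left_commute)
  then show ?thesis unfolding triangles_def by blast
qed

text \<open>Residue 3 modulo 4 marks the last row of a strip. For any other \<open>b\<close>, both
  rows of the triangle lie in one strip, so the swap acts on \<open>A\<close> as a single
  translation.\<close>

lemma strip_swap_triangle:
  assumes A: "A \<in> triangles" "snd ` A = {b, b + 1}" and b: "(b - c) mod 4 \<noteq> 3"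
  shows "strip_swap c ` A \<in> triangles"
proof -
  define t :: int where "t = (if (b - c) mod 8 < 4 then 4 else -4)"
  define m where "m = (b - c) mod 8"
  have m: "0 \<le> m" "m < 8" by (auto simp: m_def)
  have "(b - c) mod 4 = m mod 4" by (simp add: m_def mod_mod_cancel)
  \<comment> \<open>Only from 3 and 7 does a step up, taken modulo 8, change between the halves 0 to
    3 and 4 to 7.\<close>
  then have "m \<noteq> 3" "m \<noteq> 7" using b by auto
  moreover have "(b + 1 - c) mod 8 = (m + 1) mod 8"
    by (simp add: m_def mod_simps algebra_simps)
  ultimately have "(b - c) mod 8 < 4 \<longleftrightarrow> (b + 1 - c) mod 8 < 4"
    using m unfolding m_def[symmetric] by simp linarith
  moreover have "snd p = b \<or> snd p = b + 1" if "p \<in> A" for p using that A(2) by blast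
  ultimately have "strip_swap c p = (fst p, snd p + t)" if "p \<in> A" for p
    using that by (fastforce simp: strip_swap_def t_def)
  then have "strip_swap c ` A = (\<lambda>p. (fst p, snd p + t)) ` A" by (intro image_cong) auto
  then show ?thesis using translate_triangle[OF A(1)] by simp
qed

lemma card_straddling_offsets:
  assumes "A \<in> triangles"
  shows "card {c \<in> {0..<4}. strip_swap c ` A \<notin> triangles} \<le> 1"
proof -
  obtain b where b: "snd ` A = {b, b + 1}" using triangle_rows assms by blast
  have "c = (b + 1) mod 4" if "c \<in> {0..<4}" "strip_swap c ` A \<notin> triangles" for c
  proof -
    have "(b - c) mod 4 = 3" using strip_swap_triangle[OF assms b] that by blast
    moreover have "0 \<le> c" "c < 4" using that(1) by auto
    ultimately show ?thesis by presburger
  qed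
  then have "{c \<in> {0..<4}. strip_swap c ` A \<notin> triangles} \<subseteq> {(b + 1) mod 4}" by blast
  then have "card {c \<in> {0..<4}. strip_swap c ` A \<notin> triangles} \<le> card {(b + 1) mod 4}"
    by (intro card_mono) auto
  then show ?thesis by simp
qed

text \<open>Double counting: a triangle is broken by at most one of the four offsets, so the numbers
  of broken triangles sum to at most \<open>card W\<close> and cannot all exceed a quarter of
  it.\<close>

lemma obtain_offset:
  assumes W: "finite W" "W \<subseteq> triangles"
  obtains c where "4 * card {A \<in> W. strip_swap c ` A \<notin> triangles} \<le> card W"
proof (rule ccontr)
  assume "\<not> thesis"
  with that have *: "card W < 4 * card {A \<in> W. strip_swap c ` A \<notin> triangles}" for c
    by (meson not_less)
  have "4 * card W = (\<Sum>c\<in>{0..<4::int}. card W)" by simp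
  also have "\<dots> < (\<Sum>c\<in>{0..<4::int}. 4 * card {A \<in> W. strip_swap c ` A \<notin> triangles})"
    using * by (intro sum_strict_mono) auto
  also have "\<dots> = 4 * (\<Sum>c\<in>{0..<4::int}. card {A \<in> W. strip_swap c ` A \<notin> triangles})"
    by (rule sum_distrib_left[symmetric])
  also have "(\<Sum>c\<in>{0..<4::int}. card {A \<in> W. strip_swap c ` A \<notin> triangles})
      = (\<Sum>A\<in>W. card {c \<in> {0..<4}. strip_swap c ` A \<notin> triangles})"
    using sum.swap_restrict[of "{0..<4::int}" W "\<lambda>_ _. 1::nat"
        "\<lambda>c A. strip_swap c ` A \<notin> triangles"] W by simp
  also have "\<dots> \<le> (\<Sum>A\<in>W. 1)"
    using W card_straddling_offsets by (intro sum_mono) blast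
  finally show False by simp
qed

section \<open>Boundary effects\<close>

text \<open>The vertex from which the path first leaves \<open>V\<close> is a boundary vertex,
  reached in at most \<open>m\<close> steps.\<close>

lemma boundary_on_path:
  assumes "(p, q) \<in> lattice_edges ^^ m" "p \<in> V" "q \<notin> V"
  shows "\<exists>q'\<in>boundary V. \<exists>j\<le>m. (p, q') \<in> lattice_edges ^^ j"
  using assms
proof (induction m arbitrary: p)
  case (Suc m)
  then obtain r where r: "(p, r) \<in> lattice_edges" "(r, q) \<in> lattice_edges ^^ m"
    by (meson relpow_Suc_D2)
  show ?case
  proof (cases "r \<in> V")
    case True
    then obtain q' j where "q' \<in> boundary V" "j \<le> m" "(r, q') \<in> lattice_edges ^^ j"
      using Suc.IH[OF r(2)] Suc.prems by blast
    with r(1) show ?thesis by (meson Suc_le_mono relpow_Suc_I2)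
  next
    case False
    with r Suc.prems have "p \<in> boundary V" unfolding boundary_def by blast
    then show ?thesis by (metis le0 relpow_0_I)
  qed
qed auto

lemma lattice_edgeI:
  "A \<in> triangles \<Longrightarrow> p \<in> A \<Longrightarrow> q \<in> A \<Longrightarrow> p \<noteq> q \<Longrightarrow> (p, q) \<in> lattice_edges"
  unfolding lattice_edges_def by blast

lemma vertical_edge:
  "((a, b), (a, b + 1)) \<in> lattice_edges" "((a, b + 1), (a, b)) \<in> lattice_edges"
proof -
  have "{(a, b), (a + 1, b), (a, b + 1)} \<in> triangles" unfolding triangles_def by blast
  note edge = lattice_edgeI[OF this]
  show "((a, b), (a, b + 1)) \<in> lattice_edges" "((a, b + 1), (a, b)) \<in> lattice_edges"
    by (rule edge; simp)+
qed

lemma vertical_path: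
  "((a, b), (a, b + int m)) \<in> lattice_edges ^^ m"
  "((a, b + int m), (a, b)) \<in> lattice_edges ^^ m"
proof (induction m)
  case (Suc m)
  have e: "b + int (Suc m) = b + int m + 1" by simp
  {
    case 1
    show ?case unfolding e using Suc(1) vertical_edge(1) by (rule relpow_Suc_I)
  next
    case 2
    show ?case unfolding e using vertical_edge(2) Suc(2) by (rule relpow_Suc_I2)
  }
qed auto

text \<open>A vertical unit step is a lattice edge, so a swap moves a point along 4 edges. This is
  where the boundary distance 4 comes from.\<close>

lemma strip_swap_path: "(p, strip_swap c p) \<in> lattice_edges ^^ 4"
proof (cases "(snd p - c) mod 8 < 4")
  case True
  then have *: "strip_swap c p = (fst p, snd p + int 4)" by (simp add: strip_swap_def)
  show ?thesis
    unfolding * using vertical_path(1)[of "fst p" "snd p" 4] unfolding prod.collapse .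
next
  case False
  then have *: "strip_swap c p = (fst p, snd p - 4)" by (simp add: strip_swap_def)
  have p: "(fst p, snd p - 4 + int 4) = p" by simp
  show ?thesis unfolding * using vertical_path(2)[of "fst p" "snd p - 4" 4] unfolding p .
qed

lemma strip_swap_leaves_near_boundary:
  assumes "A \<in> grid_triangles V" "\<not> strip_swap c ` A \<subseteq> V"
  shows "A \<in> near_boundary 4 V"
proof -
  from assms obtain p where p: "p \<in> A" "p \<in> V" "strip_swap c p \<notin> V"
    unfolding grid_triangles_def by blast
  with boundary_on_path[OF strip_swap_path this(2,3)] assms(1) show ?thesis
    unfolding near_boundary_def by blast
qed

lemma SC2_triangles_ge:
  assumes V: "finite V"
  shows "3 * card (grid_triangles V)
    \<le> 8 * SC2 V (grid_triangles V) 2 + 4 * card (near_boundary 4 V)"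
proof -
  let ?W = "grid_triangles V"
  have W: "finite ?W" using V by (rule finite_grid_triangles)
  obtain c where c: "4 * card {A \<in> ?W. strip_swap c ` A \<notin> triangles} \<le> card ?W"
    using obtain_offset[OF W] unfolding grid_triangles_def by blast
  \<comment> \<open>The swapped triangle can fail to be a winning set in two ways: it is no longer a
    triangle, or it leaves \<open>V\<close>.\<close>
  have "?W \<subseteq> {A \<in> ?W. strip_swap c ` A \<in> ?W} \<union> {A \<in> ?W. strip_swap c ` A \<notin> triangles}
      \<union> near_boundary 4 V" (is "_ \<subseteq> ?G \<union> ?B \<union> ?N")
  proof
    fix A assume A: "A \<in> ?W"
    show "A \<in> ?G \<union> ?B \<union> ?N"
      using A strip_swap_leaves_near_boundary[OF A, of c] unfolding grid_triangles_def by blast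
  qed
  moreover have "finite ?N" using W by (simp add: near_boundary_def)
  ultimately have "card ?W \<le> card (?G \<union> ?B \<union> ?N)" using W by (intro card_mono) auto
  also have "\<dots> \<le> card ?G + card ?B + card ?N"
    by (meson card_Un_le add_le_mono1 order_trans)
  finally have "card ?W \<le> card ?G + card ?B + card ?N" .
  \<comment> \<open>The size condition reads 3 + 1 = 2 * 2. With at most a quarter of
    \<open>?W\<close> in \<open>?B\<close>, multiplying the count by 4 gives the claim.\<close>
  moreover have "card ?G \<le> 2 * SC2 V ?W 2"
    using strip_swap_involution strip_swap_neq V W
    by (rule SC2_involution) (auto simp: grid_triangles_def card_triangle)
  ultimately show ?thesis using c by linarith
qed

theorem theorem7:
  fixes \<G> :: "point set set"
  assumes "\<forall>V\<in>\<G>. finite V"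
    and "two_dimensional \<G>"
  shows "\<exists>\<epsilon> \<in> o(\<lambda>n. real n). \<forall>V\<in>\<G>.
           real (SC2 V (grid_triangles V) 2)
             \<ge> 3 * real (card (grid_triangles V)) / 8 - \<epsilon> (card (grid_triangles V))"
proof -
  obtain \<beta> where \<beta>: "\<beta> \<in> o(\<lambda>n. real n)"
    and near: "\<And>V. V \<in> \<G> \<Longrightarrow> real (card (near_boundary 4 V)) \<le> \<beta> (card (grid_triangles V))"
    using assms(2) unfolding two_dimensional_def by blast
  \<comment> \<open>Dividing the finite bound by 8 turns its boundary term into \<open>4 / 8\<close>
    of \<beta>.\<close>
  have "(\<lambda>n. \<beta> n / 2) \<in> o(\<lambda>n. real n)" using \<beta> by simp
  moreover have "3 * real (card (grid_triangles V)) / 8 - \<beta> (card (grid_triangles V)) / 2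
      \<le> real (SC2 V (grid_triangles V) 2)" if "V \<in> \<G>" for V
  proof -
    have "real (3 * card (grid_triangles V))
        \<le> real (8 * SC2 V (grid_triangles V) 2 + 4 * card (near_boundary 4 V))"
      using SC2_triangles_ge[of V] assms(1) that by (simp only: of_nat_le_iff)
    with near[OF that] show ?thesis by simp
  qed
  ultimately show ?thesis by (intro bexI[of _ "\<lambda>n. \<beta> n / 2"] ballI)
qed

end
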